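(* Let $k$ be a field of characteristic zero, $G$ a finite group, and $A$ an associative $k$-algebra equipped with an action of $G$. If $H^3_G(A;A)=0$, then every $2$-cocycle in $C^2_G(A;A)$ may be extended to an equivariant formal deformation: for every $c\in C^2_G(A;A)$ with $\delta(c)=0$ there exists an equivariant formal one-parameter deformation $m_t=\sum_{i\ge 0}m_it^i$ of $(G,A)$ with $m_1=c$.
   Context: Algebras are not assumed unital; $\otimes=\otimes_k$. An action of $G$ on an associative $k$-algebra $A$, denoted $(G,A)$, is a left action of $G$ on the set $A$ such that each $a\mapsto ga$ is $k$-linear and $(ga)(gb)=g(ab)$ for all $g\in G$, $a,b\in A$. An equivariant formal one-parameter deformation of $(G,A)$ is $m_t=\sum_{i\ge0}m_it^i$, where the $m_i\colon A\times A\to A$ are $k$-bilinear, $m_0(a,b)=ab$ is the original multiplication, $m_i(ga,gb)=g\,m_i(a,b)$ for all $i\ge1$, $g\in G$, $a,b\in A$, and the $k[[t]]$-bilinear multiplication on $A[[t]]$ defined by $m_t$ (extended to power series by $m_t(\sum_i a_it^i,\sum_j b_jt^j)=\sum_{l,i,j}m_l(a_i,b_j)t^{l+i+j}$) is associative, equivalently for every $r\ge 0$ and all $a,b,c\in A$, $$\sum_{p+q=r,\ p,q\ge 0}\bigl(m_p(m_q(a,b),c)-m_p(a,m_q(b,c))\bigr)=0.$$ Equivariant Hochschild complex: for $n\ge1$, $C^n(A;A)=\mathrm{Hom}_k(A^{\otimes n},A)$ with coboundary $$\delta(f)(x_1,\dots,x_{n+1})=x_1f(x_2,\dots,x_{n+1})+\sum_{i=1}^{n}(-1)^if(x_1,\dots,x_ix_{i+1},\dots,x_{n+1})+(-1)^{n+1}f(x_1,\dots,x_n)x_{n+1}.$$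 $C^n_G(A;A)\subseteq C^n(A;A)$ is the subspace of cochains $c$ with $c(ga_1,\dots,ga_n)=g\,c(a_1,\dots,a_n)$ for all $g\in G$; the coboundary $\delta$ restricts to $C^\sharp_G(A;A)$, and $H^n_G(A;A)$ is the $n$-th cohomology of $(C^\sharp_G(A;A),\delta)$. *)

theory Defs
  imports Complex_Main "HOL-Algebra.Group_Action" "HOL-Computational_Algebra.Formal_Power_Series"
begin

text \<open>The type class \<open>ring\<close> is that of associative rings that need not have a unit.\<close>

locale assoc_algebra = vector_space scale
  for scale :: "'k::field \<Rightarrow> 'a::ring \<Rightarrow> 'a" +
  assumes scale_mult_left: "scale r x * y = scale r (x * y)"
    and mult_scale_right: "x * scale r y = scale r (x * y)"

locale algebra_action = assoc_algebra scale + group_action G UNIV \<phi>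
  for scale :: "'k::field \<Rightarrow> 'a::ring \<Rightarrow> 'a"
    and G :: "('g, 'm) monoid_scheme" (structure)
    and \<phi> :: "'g \<Rightarrow> 'a \<Rightarrow> 'a" +
  assumes action_linear: "g \<in> carrier G \<Longrightarrow> Vector_Spaces.linear scale scale (\<phi> g)"
    and action_mult: "g \<in> carrier G \<Longrightarrow> \<phi> g a * \<phi> g b = \<phi> g (a * b)"


subsection \<open>The equivariant Hochschild complex\<close>

text \<open>
  An element of \<open>C\<^sup>n(A;A)\<close> is a \<open>k\<close>-multilinear map in \<open>n\<close> arguments, represented as a function on
  lists that is fixed to be \<open>0\<close> on lists of length other than \<open>n\<close>, so that equality of cochains is
  equality of functions.
\<close>

context assoc_algebra
begin

definition cochains :: "nat \<Rightarrow> ('a list \<Rightarrow> 'a) set" where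
  "cochains n = {f.
     (\<forall>xs i. length xs = n \<longrightarrow> i < n \<longrightarrow>
        Vector_Spaces.linear scale scale (\<lambda>x. f (xs[i := x]))) \<and>
     (\<forall>xs. length xs \<noteq> n \<longrightarrow> f xs = 0)}"

text \<open>
  The argument \<open>n\<close> is the degree of \<open>f\<close>. List positions start at \<open>0\<close>, so the factors \<open>x\<^sub>i\<close> and
  \<open>x\<^sub>i\<^sub>+\<^sub>1\<close> of the \<open>i\<close>-th summand are \<open>xs ! (i - 1)\<close> and \<open>xs ! i\<close>. Signs act through \<open>scale\<close>
  because the algebra need not have a unit.
\<close>

definition coboundary :: "nat \<Rightarrow> ('a list \<Rightarrow> 'a) \<Rightarrow> 'a list \<Rightarrow> 'a" where
  "coboundary n f = (\<lambda>xs. if length xs = n + 1 then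
       hd xs * f (tl xs)
       + (\<Sum>i = 1..n. scale ((-1) ^ i)
            (f (take (i - 1) xs @ [xs ! (i - 1) * xs ! i] @ drop (i + 1) xs)))
       + scale ((-1) ^ (n + 1)) (f (butlast xs) * last xs)
     else 0)"

end

context algebra_action
begin

definition equiv_cochains :: "nat \<Rightarrow> ('a list \<Rightarrow> 'a) set" where
  "equiv_cochains n = {c \<in> cochains n.
     \<forall>g \<in> carrier G. \<forall>xs. length xs = n \<longrightarrow> c (map (\<phi> g) xs) = \<phi> g (c xs)}"

definition equiv_cocycles :: "nat \<Rightarrow> ('a list \<Rightarrow> 'a) set" where
  "equiv_cocycles n = {c \<in> equiv_cochains n. coboundary n c = (\<lambda>_. 0)}"

text \<open>The complex starts in degree \<open>1\<close>, so there are no nonzero coboundaries in degree \<open>1\<close>.\<close>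

definition equiv_coboundaries :: "nat \<Rightarrow> ('a list \<Rightarrow> 'a) set" where
  "equiv_coboundaries n =
     (if n \<le> 1 then {\<lambda>_. 0} else coboundary (n - 1) ` equiv_cochains (n - 1))"

definition equiv_cocycle_group :: "nat \<Rightarrow> ('a list \<Rightarrow> 'a) monoid" where
  "equiv_cocycle_group n =
     \<lparr>carrier = equiv_cocycles n, monoid.mult = (\<lambda>f h xs. f xs + h xs), one = (\<lambda>_. 0)\<rparr>"

text \<open>\<open>H\<^sup>n\<^sub>G(A;A)\<close>, as an abelian group written multiplicatively; scalar multiplication is not recorded.\<close>

definition equiv_cohomology :: "nat \<Rightarrow> ('a list \<Rightarrow> 'a) set monoid" where
  "equiv_cohomology n = equiv_cocycle_group n Mod equiv_coboundaries n"

end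


subsection \<open>Equivariant formal deformations\<close>

text \<open>The type \<open>'a fps\<close> serves as the carrier of \<open>A[[t]]\<close>.\<close>

definition deformed_mult :: "(nat \<Rightarrow> 'a \<Rightarrow> 'a \<Rightarrow> 'a) \<Rightarrow> 'a fps \<Rightarrow> 'a fps \<Rightarrow> 'a::ring fps" where
  "deformed_mult m u v =
     Abs_fps (\<lambda>n. \<Sum>(l, i, j) \<in> {(l, i, j). l + i + j = n}. m l (fps_nth u i) (fps_nth v j))"

definition (in algebra_action) equiv_formal_deformation :: "(nat \<Rightarrow> 'a \<Rightarrow> 'a \<Rightarrow> 'a) \<Rightarrow> bool" where
  "equiv_formal_deformation m \<longleftrightarrow>
     (\<forall>i a. Vector_Spaces.linear scale scale (\<lambda>b. m i a b)) \<and>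
     (\<forall>i b. Vector_Spaces.linear scale scale (\<lambda>a. m i a b)) \<and>
     (\<forall>a b. m 0 a b = a * b) \<and>
     (\<forall>i \<ge> 1. \<forall>g \<in> carrier G. \<forall>a b. m i (\<phi> g a) (\<phi> g b) = \<phi> g (m i a b)) \<and>
     (\<forall>u v w. deformed_mult m (deformed_mult m u v) w = deformed_mult m u (deformed_mult m v w))"

end

theory Submission imports Defs begin

text \<open>
  The deformation is built one coefficient at a time. A bilinear equivariant family
  \<open>m\<^sub>0, \<dots>, m\<^sub>r\<^sub>-\<^sub>1\<close>, extended by \<open>0\<close>, makes \<open>A[[t]]\<close> a nonassociative algebra. If its associator
  vanishes below order \<open>r\<close>, then the coefficient of \<open>t\<^sup>r\<close> in the pentagon identity between associators,
  which holds in every nonassociative algebra, says that the leading coefficient of the associator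
  is a Hochschild 3-cocycle. As \<open>H\<^sup>3\<^sub>G(A;A) = 0\<close>, it is the coboundary of an equivariant 2-cochain, and
  taking this cochain as \<open>m\<^sub>r\<close> makes the associator vanish in order \<open>r\<close> as well.
\<close>

section \<open>Products and associators of formal power series\<close>

lemma finite_triples_sum_eq: "finite {(l, i, j). l + i + j = (n::nat)}"
  by (rule finite_subset[of _ "{..n} \<times> {..n} \<times> {..n}"]) auto

lemma finite_quadruples_sum_eq: "finite {(l, i, j, k). l + i + j + k = (n::nat)}"
  by (rule finite_subset[of _ "{..n} \<times> {..n} \<times> {..n} \<times> {..n}"]) auto

lemma finite_pairs_sum_eq: "finite {(p, q). p + q = (n::nat)}"
  by (rule finite_subset[of _ "{..n} \<times> {..n}"]) auto

lemma fps_nth_deformed_mult: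
  "fps_nth (deformed_mult m u v) n =
     (\<Sum>(l, i, j) \<in> {(l, i, j). l + i + j = n}. m l (fps_nth u i) (fps_nth v j))"
  by (simp add: deformed_mult_def)

text \<open>For a biadditive family this is the coefficient of t^r in m_t(m_t(a,b),c) -
  m_t(a,m_t(b,c)), that is, the left-hand side of the deformation equation of order r.\<close>

definition associator :: "(nat \<Rightarrow> 'a \<Rightarrow> 'a \<Rightarrow> 'a) \<Rightarrow> nat \<Rightarrow> 'a \<Rightarrow> 'a \<Rightarrow> 'a \<Rightarrow> 'a::ring" where
  "associator m r a b c =
     (\<Sum>(p, q) \<in> {(p, q). p + q = r}. m p (m q a b) c - m p a (m q b c))"

text \<open>Multiplying out differences and discarding zero coefficients uses additivity in each
  argument and no scalars, so this part is stated over an arbitrary, possibly non-unital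
  ring.\<close>

locale biadditive_family =
  fixes m :: "nat \<Rightarrow> 'a::ring \<Rightarrow> 'a \<Rightarrow> 'a"
  assumes add_left: "m i (a + b) c = m i a c + m i b c"
    and add_right: "m i a (b + c) = m i a b + m i a c"
begin

sublocale left: additive "\<lambda>a. m i a c" for i c
  by unfold_locales (rule add_left)

sublocale right: additive "\<lambda>c. m i a c" for i a
  by unfold_locales (rule add_right)

lemma deformed_mult_diff_left:
  "deformed_mult m (u - v) w = deformed_mult m u w - deformed_mult m v w"
  by (rule fps_ext)
    (simp add: fps_nth_deformed_mult left.diff case_prod_unfold sum_subtractf)

lemma deformed_mult_diff_right:
  "deformed_mult m u (v - w) = deformed_mult m u v - deformed_mult m u w"
  by (rule fps_ext)
    (simp add: fps_nth_deformed_mult right.diff case_prod_unfold sum_subtractf)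

definition fps_associator :: "'a fps \<Rightarrow> 'a fps \<Rightarrow> 'a fps \<Rightarrow> 'a fps" where
  "fps_associator u v w =
     deformed_mult m (deformed_mult m u v) w - deformed_mult m u (deformed_mult m v w)"

text \<open>Both bracketings are brought to one index set: l is the order contributed by the two
  multiplications together, and i, j, k are the orders of the three arguments. Their difference can
  then be taken term by term and collects into values of \<open>associator m l\<close>.\<close>

lemma fps_nth_deformed_mult_left_nested:
  "fps_nth (deformed_mult m (deformed_mult m u v) w) n =
     (\<Sum>(l, i, j, k) \<in> {(l, i, j, k). l + i + j + k = n}. \<Sum>(p, q) \<in> {(p, q). p + q = l}.
        m p (m q (fps_nth u i) (fps_nth v j)) (fps_nth w k))"
proof -
  let ?T = "\<lambda>n::nat. {(l, i, j). l + i + j = n}"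
  let ?Q = "{(l, i, j, k). l + i + j + k = n}"
  let ?P = "\<lambda>l::nat. {(p, q). p + q = l}"
  have "fps_nth (deformed_mult m (deformed_mult m u v) w) n =
    (\<Sum>x\<in>?T n. \<Sum>y\<in>?T (fst (snd x)).
        m (fst x) (m (fst y) (fps_nth u (fst (snd y))) (fps_nth v (snd (snd y)))) (fps_nth w (snd (snd x))))"
    by (simp add: fps_nth_deformed_mult left.sum case_prod_unfold)
  also have "\<dots> = (\<Sum>(x, y)\<in>Sigma (?T n) (\<lambda>x. ?T (fst (snd x))).
        m (fst x) (m (fst y) (fps_nth u (fst (snd y))) (fps_nth v (snd (snd y)))) (fps_nth w (snd (snd x))))"
    by (rule sum.Sigma) (auto intro: finite_triples_sum_eq)
  also have "\<dots> = (\<Sum>(x, y)\<in>Sigma ?Q (\<lambda>x. ?P (fst x)).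
        m (fst y) (m (snd y) (fps_nth u (fst (snd x))) (fps_nth v (fst (snd (snd x))))) (fps_nth w (snd (snd (snd x)))))"
    by (rule sum.reindex_bij_witness
        [where i = "\<lambda>((l, i, j, k), (p, q)). ((p, q + i + j, k), (q, i, j))"
           and j = "\<lambda>((p, e, k), (q, i, j)). ((p + q, i, j, k), (p, q))"]) auto
  also have "\<dots> = (\<Sum>x\<in>?Q. \<Sum>y\<in>?P (fst x).
        m (fst y) (m (snd y) (fps_nth u (fst (snd x))) (fps_nth v (fst (snd (snd x))))) (fps_nth w (snd (snd (snd x)))))"
    by (rule sum.Sigma[symmetric]) (auto intro: finite_quadruples_sum_eq finite_pairs_sum_eq)
  finally show ?thesis
    by (simp add: case_prod_unfold)
qed

lemma fps_nth_deformed_mult_right_nested: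
  "fps_nth (deformed_mult m u (deformed_mult m v w)) n =
     (\<Sum>(l, i, j, k) \<in> {(l, i, j, k). l + i + j + k = n}. \<Sum>(p, q) \<in> {(p, q). p + q = l}.
        m p (fps_nth u i) (m q (fps_nth v j) (fps_nth w k)))"
proof -
  let ?T = "\<lambda>n::nat. {(l, i, j). l + i + j = n}"
  let ?Q = "{(l, i, j, k). l + i + j + k = n}"
  let ?P = "\<lambda>l::nat. {(p, q). p + q = l}"
  have "fps_nth (deformed_mult m u (deformed_mult m v w)) n =
    (\<Sum>x\<in>?T n. \<Sum>y\<in>?T (snd (snd x)).
        m (fst x) (fps_nth u (fst (snd x))) (m (fst y) (fps_nth v (fst (snd y))) (fps_nth w (snd (snd y)))))"
    by (simp add: fps_nth_deformed_mult right.sum case_prod_unfold)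
  also have "\<dots> = (\<Sum>(x, y)\<in>Sigma (?T n) (\<lambda>x. ?T (snd (snd x))).
        m (fst x) (fps_nth u (fst (snd x))) (m (fst y) (fps_nth v (fst (snd y))) (fps_nth w (snd (snd y)))))"
    by (rule sum.Sigma) (auto intro: finite_triples_sum_eq)
  also have "\<dots> = (\<Sum>(x, y)\<in>Sigma ?Q (\<lambda>x. ?P (fst x)).
        m (fst y) (fps_nth u (fst (snd x))) (m (snd y) (fps_nth v (fst (snd (snd x)))) (fps_nth w (snd (snd (snd x))))))"
    by (rule sum.reindex_bij_witness
        [where i = "\<lambda>((l, i, j, k), (p, q)). ((p, i, q + j + k), (q, j, k))"
           and j = "\<lambda>((p, i, e), (q, j, k)). ((p + q, i, j, k), (p, q))"]) auto
  also have "\<dots> = (\<Sum>x\<in>?Q. \<Sum>y\<in>?P (fst x).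
        m (fst y) (fps_nth u (fst (snd x))) (m (snd y) (fps_nth v (fst (snd (snd x)))) (fps_nth w (snd (snd (snd x))))))"
    by (rule sum.Sigma[symmetric]) (auto intro: finite_quadruples_sum_eq finite_pairs_sum_eq)
  finally show ?thesis
    by (simp add: case_prod_unfold)
qed

lemma fps_nth_fps_associator:
  "fps_nth (fps_associator u v w) n =
     (\<Sum>(l, i, j, k) \<in> {(l, i, j, k). l + i + j + k = n}.
        associator m l (fps_nth u i) (fps_nth v j) (fps_nth w k))"
  by (simp add: fps_associator_def fps_nth_deformed_mult_left_nested
      fps_nth_deformed_mult_right_nested associator_def case_prod_unfold sum_subtractf)

lemma deformed_mult_assoc:
  assumes "\<And>r a b c. associator m r a b c = 0"
  shows "deformed_mult m (deformed_mult m u v) w = deformed_mult m u (deformed_mult m v w)"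
proof -
  have "fps_associator u v w = 0"
    by (rule fps_ext) (simp add: fps_nth_fps_associator assms case_prod_unfold)
  then show ?thesis
    by (simp add: fps_associator_def)
qed

text \<open>Expanding by biadditivity, each of the five bracketings of u, v, w, x occurs twice, with
  opposite signs.\<close>

lemma fps_associator_pentagon:
  "deformed_mult m u (fps_associator v w x) - fps_associator (deformed_mult m u v) w x
     + fps_associator u (deformed_mult m v w) x - fps_associator u v (deformed_mult m w x)
     + deformed_mult m (fps_associator u v w) x = 0"
  by (simp add: fps_associator_def deformed_mult_diff_left deformed_mult_diff_right)

text \<open>A nonzero summand needs i >= r, and l + i + j = r then forces l = j = 0. With r = 0 the
  premise is vacuous, which gives the constant term of any product.\<close>

lemma fps_nth_deformed_mult_left_leading:
  assumes "\<And>i. i < r \<Longrightarrow> fps_nth u i = 0"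
  shows "fps_nth (deformed_mult m u v) r = m 0 (fps_nth u r) (fps_nth v 0)"
proof -
  have "fps_nth (deformed_mult m u v) r =
    (\<Sum>(l, i, j) \<in> {(0, r, 0)}. m l (fps_nth u i) (fps_nth v j))"
    unfolding fps_nth_deformed_mult
  proof (rule sum.mono_neutral_right[OF finite_triples_sum_eq])
    show "\<forall>x \<in> {(l, i, j). l + i + j = r} - {(0, r, 0)}.
        (case x of (l, i, j) \<Rightarrow> m l (fps_nth u i) (fps_nth v j)) = 0"
    proof
      fix x assume x: "x \<in> {(l, i, j). l + i + j = r} - {(0, r, 0)}"
      obtain l i j where "x = (l, i, j)" by (cases x)
      moreover from this x have "i < r" by auto
      ultimately show "(case x of (l, i, j) \<Rightarrow> m l (fps_nth u i) (fps_nth v j)) = 0"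
        by (simp add: assms left.zero)
    qed
  qed simp
  then show ?thesis by simp
qed

lemma fps_nth_deformed_mult_right_leading:
  assumes "\<And>j. j < r \<Longrightarrow> fps_nth v j = 0"
  shows "fps_nth (deformed_mult m u v) r = m 0 (fps_nth u 0) (fps_nth v r)"
proof -
  have "fps_nth (deformed_mult m u v) r =
    (\<Sum>(l, i, j) \<in> {(0, 0, r)}. m l (fps_nth u i) (fps_nth v j))"
    unfolding fps_nth_deformed_mult
  proof (rule sum.mono_neutral_right[OF finite_triples_sum_eq])
    show "\<forall>x \<in> {(l, i, j). l + i + j = r} - {(0, 0, r)}.
        (case x of (l, i, j) \<Rightarrow> m l (fps_nth u i) (fps_nth v j)) = 0"
    proof
      fix x assume x: "x \<in> {(l, i, j). l + i + j = r} - {(0, 0, r)}"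
      obtain l i j where "x = (l, i, j)" by (cases x)
      moreover from this x have "j < r" by auto
      ultimately show "(case x of (l, i, j) \<Rightarrow> m l (fps_nth u i) (fps_nth v j)) = 0"
        by (simp add: assms right.zero)
    qed
  qed simp
  then show ?thesis by simp
qed

context
  fixes r :: nat
  assumes assoc_below: "\<And>l a b c. l < r \<Longrightarrow> associator m l a b c = 0"
begin

lemma fps_nth_fps_associator_less: "n < r \<Longrightarrow> fps_nth (fps_associator u v w) n = 0"
  unfolding fps_nth_fps_associator by (rule sum.neutral) (auto simp: assoc_below)

lemma fps_nth_fps_associator_leading:
  "fps_nth (fps_associator u v w) r = associator m r (fps_nth u 0) (fps_nth v 0) (fps_nth w 0)"
proof -
  have "fps_nth (fps_associator u v w) r =
    (\<Sum>(l, i, j, k) \<in> {(r, 0, 0, 0)}. associator m l (fps_nth u i) (fps_nth v j) (fps_nth w k))"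
    unfolding fps_nth_fps_associator
  proof (rule sum.mono_neutral_right[OF finite_quadruples_sum_eq])
    show "\<forall>x \<in> {(l, i, j, k). l + i + j + k = r} - {(r, 0, 0, 0)}.
        (case x of (l, i, j, k) \<Rightarrow> associator m l (fps_nth u i) (fps_nth v j) (fps_nth w k)) = 0"
    proof
      fix x assume x: "x \<in> {(l, i, j, k). l + i + j + k = r} - {(r, 0, 0, 0)}"
      obtain l i j k where "x = (l, i, j, k)" by (cases x)
      moreover from this x have "l < r" by auto
      ultimately show
        "(case x of (l, i, j, k) \<Rightarrow> associator m l (fps_nth u i) (fps_nth v j) (fps_nth w k)) = 0"
        by (simp add: assoc_below)
    qed
  qed simp
  then show ?thesis by simp
qed

text \<open>This is the coefficient of t^r in the pentagon identity at constant series. All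
  associators there start at order r, so outer products contribute only through \<open>m 0\<close>,
  and associators see only the constant terms of their arguments.\<close>

lemma associator_cocycle:
  "m 0 a (associator m r b c d) - associator m r (m 0 a b) c d + associator m r a (m 0 b c) d
     - associator m r a b (m 0 c d) + m 0 (associator m r a b c) d = 0"
proof -
  \<comment> \<open>Needed for the three middle terms, where a product is an argument of an
    associator.\<close>
  have "fps_nth (deformed_mult m u v) 0 = m 0 (fps_nth u 0) (fps_nth v 0)" for u v
    by (rule fps_nth_deformed_mult_left_leading) simp
  with arg_cong[OF fps_associator_pentagon[of "fps_const a" "fps_const b" "fps_const c" "fps_const d"],
      of "\<lambda>u. fps_nth u r"]
  show ?thesis
    by (simp add: fps_nth_deformed_mult_left_leading fps_nth_deformed_mult_right_leading
        fps_nth_fps_associator_less fps_nth_fps_associator_leading)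
qed

end

end

section \<open>Effect of one new coefficient on the associator\<close>

lemma associator_cong:
  assumes "\<And>i. i \<le> r \<Longrightarrow> m i = m' i"
  shows "associator m r = associator m' r"
  unfolding associator_def by (intro ext sum.cong) (auto simp: assms)

text \<open>In order r the new coefficient f meets only \<open>m 0\<close>, in the summands (0, r)
  and (r, 0). Since \<open>m 0\<close> is the multiplication, these amount to minus the Hochschild
  coboundary of f.\<close>

lemma associator_fun_upd:
  fixes f :: "'a \<Rightarrow> 'a \<Rightarrow> 'a::ring"
  assumes r: "0 < r" and zero: "m r = (\<lambda>_ _. 0)" and m0: "m 0 = (*)"
  shows "associator (m(r := f)) r a b c =
    associator m r a b c - (a * f b c - f (a * b) c + f a (b * c) - f a b * c)"
proof -
  let ?m = "m(r := f)"
  let ?d = "\<lambda>(p, q). (?m p (?m q a b) c - ?m p a (?m q b c)) - (m p (m q a b) c - m p a (m q b c))"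
  have "associator ?m r a b c - associator m r a b c = sum ?d {(p, q). p + q = r}"
    by (simp add: associator_def sum_subtractf case_prod_unfold del: fun_upd_apply)
  \<comment> \<open>In every other summand p and q both differ from r, so the update is invisible.
    The two pairs that remain are distinct because 0 < r.\<close>
  also have "\<dots> = sum ?d {(0, r), (r, 0)}"
  proof (rule sum.mono_neutral_right[OF finite_pairs_sum_eq])
    show "\<forall>x \<in> {(p, q). p + q = r} - {(0, r), (r, 0)}. ?d x = 0"
    proof
      fix x assume x: "x \<in> {(p, q). p + q = r} - {(0, r), (r, 0)}"
      obtain p q where "x = (p, q)" by (cases x)
      moreover from this x have "p \<noteq> r" "q \<noteq> r" by auto
      ultimately show "?d x = 0" by simp
    qed
  qed auto
  also have "\<dots> = - (a * f b c - f (a * b) c + f a (b * c) - f a b * c)"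
    using r by (simp add: zero m0)
  finally show ?thesis
    by (simp add: algebra_simps)
qed

section \<open>Bilinear maps and Hochschild cochains in low degrees\<close>

lemma length_eq_3_iff: "length xs = 3 \<longleftrightarrow> (\<exists>a b c. xs = [a, b, c])"
  by (auto simp: numeral_3_eq_3 length_Suc_conv)

context assoc_algebra
begin

lemma linear_iff:
  "Vector_Spaces.linear scale scale f \<longleftrightarrow>
     (\<forall>x y. f (x + y) = f x + f y) \<and> (\<forall>r x. f (scale r x) = scale r (f x))"
  using vector_space_axioms by (auto simp: Vector_Spaces.linear_iff)

lemma coboundary_2:
  "coboundary 2 f [a, b, c] = a * f [b, c] - f [a * b, c] + f [a, b * c] - f [a, b] * c"
  by (simp add: coboundary_def numeral_2_eq_2 scale_minus_left)

lemma coboundary_3: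
  "coboundary 3 f [a, b, c, d] =
     a * f [b, c, d] - f [a * b, c, d] + f [a, b * c, d] - f [a, b, c * d] + f [a, b, c] * d"
  by (simp add: coboundary_def numeral_3_eq_3 scale_minus_left)

definition bilinear_map :: "('a \<Rightarrow> 'a \<Rightarrow> 'a) \<Rightarrow> bool" where
  "bilinear_map f \<longleftrightarrow> (\<forall>a. Vector_Spaces.linear scale scale (\<lambda>b. f a b)) \<and>
     (\<forall>b. Vector_Spaces.linear scale scale (\<lambda>a. f a b))"

lemma bilinear_map_cochain:
  assumes "f \<in> cochains 2"
  shows "bilinear_map (\<lambda>a b. f [a, b])"
proof -
  have "Vector_Spaces.linear scale scale (\<lambda>x. f ([a, b][i := x]))" if "i < 2" for a b i
    using assms that by (simp add: cochains_def del: list_update.simps)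
  from this[of 0] this[of 1] show ?thesis
    by (simp add: bilinear_map_def)
qed

lemma bilinear_map_mult: "bilinear_map (*)"
  by (simp add: bilinear_map_def linear_iff algebra_simps scale_mult_left mult_scale_right)

lemma bilinear_map_zero: "bilinear_map (\<lambda>_ _. 0)"
  by (simp add: bilinear_map_def linear_iff)

lemma biadditive_family_bilinear:
  assumes "\<And>i. bilinear_map (m i)"
  shows "biadditive_family m"
  using assms by unfold_locales (auto simp: bilinear_map_def linear_iff)

text \<open>The value 0 off length 3 is the normalisation that \<open>cochains\<close>
  demands.\<close>

definition cochain3 :: "('a \<Rightarrow> 'a \<Rightarrow> 'a \<Rightarrow> 'a) \<Rightarrow> 'a list \<Rightarrow> 'a" where
  "cochain3 f xs = (if length xs = 3 then f (xs ! 0) (xs ! 1) (xs ! 2) else 0)"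

lemma cochain3_associator_mem:
  assumes "\<And>i. bilinear_map (m i)"
  shows "cochain3 (associator m r) \<in> cochains 3"
proof -
  have m: "m i (a + b) c = m i a c + m i b c" "m i c (a + b) = m i c a + m i c b"
    "m i (scale s a) c = scale s (m i a c)" "m i c (scale s a) = scale s (m i c a)" for i a b c s
    using assms[of i] by (auto simp: bilinear_map_def linear_iff)
  have "Vector_Spaces.linear scale scale (\<lambda>x. associator m r x b c)"
    "Vector_Spaces.linear scale scale (\<lambda>x. associator m r a x c)"
    "Vector_Spaces.linear scale scale (\<lambda>x. associator m r a b x)" for a b c
    by (auto simp: linear_iff associator_def m case_prod_unfold scale_sum_right
        scale_right_diff_distrib simp flip: sum.distrib intro!: sum.cong)
  then show ?thesis
    by (auto simp: cochains_def length_eq_3_iff cochain3_def less_Suc_eq eval_nat_numeral)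
qed

text \<open>With \<open>m 0\<close> equal to the multiplication, the identity
  \<open>associator_cocycle\<close> is the formula for the coboundary in degree 3; on lists of
  length other than 4 the coboundary is 0 by convention.\<close>

lemma coboundary_cochain3_associator:
  assumes "\<And>i. bilinear_map (m i)" and m0: "m 0 = (*)"
    and "\<And>l a b c. l < r \<Longrightarrow> associator m l a b c = 0"
  shows "coboundary 3 (cochain3 (associator m r)) = (\<lambda>_. 0)"
proof
  fix xs :: "'a list"
  interpret biadditive_family m
    using assms(1) by (rule biadditive_family_bilinear)
  show "coboundary 3 (cochain3 (associator m r)) xs = 0"
  proof (cases "length xs = 4")
    case True
    then obtain a b c d where "xs = [a, b, c, d]"
      by (auto simp: numeral_eq_Suc length_Suc_conv)
    then show ?thesis
      using associator_cocycle[where r = r and a = a and b = b and c = c and d = d] assms(3)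
      by (simp add: coboundary_3 cochain3_def m0)
  qed (simp add: coboundary_def)
qed

end

section \<open>Equivariance and exactness in degree 3\<close>

context algebra_action
begin

definition equivariant_map :: "('a \<Rightarrow> 'a \<Rightarrow> 'a) \<Rightarrow> bool" where
  "equivariant_map f \<longleftrightarrow> (\<forall>g \<in> carrier G. \<forall>a b. f (\<phi> g a) (\<phi> g b) = \<phi> g (f a b))"

lemma action_additive:
  assumes "g \<in> carrier G"
  shows "additive (\<phi> g)"
  using action_linear[OF assms] by (auto simp: linear_iff intro: additive.intro)

lemma equivariant_map_mult: "equivariant_map (*)"
  by (simp add: equivariant_map_def action_mult)

lemma equivariant_map_zero: "equivariant_map (\<lambda>_ _. 0)"
  by (simp add: equivariant_map_def additive.zero[OF action_additive])

lemma equivariant_map_cochain: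
  assumes "f \<in> equiv_cochains 2"
  shows "equivariant_map (\<lambda>a b. f [a, b])"
proof -
  have "f (map (\<phi> g) [a, b]) = \<phi> g (f [a, b])" if "g \<in> carrier G" for g a b
    using assms that by (auto simp: equiv_cochains_def simp del: list.map)
  then show ?thesis
    by (simp add: equivariant_map_def)
qed

lemma cochain3_associator_equiv:
  assumes "\<And>i. bilinear_map (m i)" and "\<And>i. equivariant_map (m i)"
  shows "cochain3 (associator m r) \<in> equiv_cochains 3"
proof -
  have m: "m i (\<phi> g a) (\<phi> g b) = \<phi> g (m i a b)" if "g \<in> carrier G" for i g a b
    using assms(2)[of i] that by (simp add: equivariant_map_def)
  have "associator m r (\<phi> g a) (\<phi> g b) (\<phi> g c) = \<phi> g (associator m r a b c)"
    if g: "g \<in> carrier G" for g a b c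
    using g by (simp add: associator_def m additive.sum[OF action_additive[OF g]]
        additive.diff[OF action_additive[OF g]] case_prod_unfold)
  then show ?thesis
    using cochain3_associator_mem[OF assms(1)]
    by (auto simp: equiv_cochains_def cochain3_def)
qed

text \<open>Triviality of the quotient makes the coset of z equal to the set of coboundaries. As 0
  is a coboundary, z lies in its own coset and hence is a coboundary.\<close>

lemma equiv_cocycle_3_exact:
  assumes triv: "carrier (equiv_cohomology 3) = {\<one>\<^bsub>equiv_cohomology 3\<^esub>}"
    and z: "z \<in> equiv_cocycles 3"
  obtains f where "f \<in> equiv_cochains 2" and "z = coboundary 2 f"
proof -
  let ?Z = "equiv_cocycle_group 3" and ?B = "equiv_coboundaries 3"
  have zero: "(\<lambda>_. 0) \<in> ?B"
  proof -
    have "(\<lambda>_. 0) \<in> equiv_cochains 2"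
      by (auto simp: equiv_cochains_def cochains_def linear_iff additive.zero[OF action_additive])
    moreover have "coboundary 2 (\<lambda>_. 0) = (\<lambda>_. 0)"
      by (auto simp: coboundary_def)
    ultimately show ?thesis
      by (force simp: equiv_coboundaries_def image_iff)
  qed
  have "?B #>\<^bsub>?Z\<^esub> z \<in> carrier (equiv_cohomology 3)"
    using z by (auto simp: equiv_cohomology_def FactGroup_def RCOSETS_def equiv_cocycle_group_def)
  then have "?B #>\<^bsub>?Z\<^esub> z = ?B"
    using triv by (simp add: equiv_cohomology_def FactGroup_def)
  moreover have "z \<in> ?B #>\<^bsub>?Z\<^esub> z"
    using zero by (force simp: r_coset_def equiv_cocycle_group_def)
  ultimately show ?thesis
    using that by (auto simp: equiv_coboundaries_def)
qed

section \<open>Truncated deformations and passage to the limit\<close>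

definition truncated_deformation :: "nat \<Rightarrow> (nat \<Rightarrow> 'a \<Rightarrow> 'a \<Rightarrow> 'a) \<Rightarrow> bool" where
  "truncated_deformation r m \<longleftrightarrow>
     (\<forall>i. bilinear_map (m i)) \<and> (\<forall>i. equivariant_map (m i)) \<and> m 0 = (*) \<and>
     (\<forall>i \<ge> r. m i = (\<lambda>_ _. 0)) \<and> (\<forall>l < r. \<forall>a b c. associator m l a b c = 0)"

text \<open>The obstruction in order r is the associator computed with \<open>m r\<close> = 0. It is
  an equivariant 3-cocycle, hence the coboundary of some f, and inserting f in place of the zero
  coefficient cancels it.\<close>

lemma truncated_deformation_extend:
  assumes triv: "carrier (equiv_cohomology 3) = {\<one>\<^bsub>equiv_cohomology 3\<^esub>}"
    and m: "truncated_deformation r m" and "0 < r"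
  obtains f where "truncated_deformation (Suc r) (m(r := f))"
proof -
  have bil: "bilinear_map (m i)" and eqv: "equivariant_map (m i)" and m0: "m 0 = (*)"
    and zero: "r \<le> i \<Longrightarrow> m i = (\<lambda>_ _. 0)"
    and assoc: "l < r \<Longrightarrow> associator m l a b c = 0" for i l a b c
    using m by (auto simp: truncated_deformation_def)
  have "cochain3 (associator m r) \<in> equiv_cocycles 3"
    using cochain3_associator_equiv[OF bil eqv] coboundary_cochain3_associator[OF bil m0 assoc]
    by (simp add: equiv_cocycles_def)
  then obtain f where f: "f \<in> equiv_cochains 2" and eq: "cochain3 (associator m r) = coboundary 2 f"
    by (rule equiv_cocycle_3_exact[OF triv])
  let ?f = "\<lambda>a b. f [a, b]"
  have "associator m r a b c = a * ?f b c - ?f (a * b) c + ?f a (b * c) - ?f a b * c" for a b c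
    using fun_cong[OF eq, of "[a, b, c]"] by (simp add: coboundary_2 cochain3_def)
  \<comment> \<open>No sign change of f is required, since \<open>associator_fun_upd\<close>
    subtracts its coboundary.\<close>
  then have "associator (m(r := ?f)) r a b c = 0" for a b c
    using associator_fun_upd[of r m ?f a b c] \<open>0 < r\<close> zero m0 by simp
  \<comment> \<open>The associator of order l involves only coefficients of index at most l, so
    lower orders are undisturbed.\<close>
  moreover have "associator (m(r := ?f)) l a b c = 0" if "l < r" for l a b c
    using associator_cong[of l "m(r := ?f)" m] assoc that by simp
  moreover have "bilinear_map ?f" and "equivariant_map ?f"
    using f bilinear_map_cochain equivariant_map_cochain by (auto simp: equiv_cochains_def)
  ultimately have "truncated_deformation (Suc r) (m(r := ?f))"
    using \<open>0 < r\<close> bil eqv m0 zero by (auto simp: truncated_deformation_def less_Suc_eq)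
  then show ?thesis by (rule that)
qed

text \<open>Order 0 is associativity of A, and order 1 is the cocycle condition on c.\<close>

lemma truncated_deformation_cocycle:
  assumes c: "c \<in> equiv_cochains 2" and "coboundary 2 c = (\<lambda>_. 0)"
  shows "truncated_deformation 2 ((\<lambda>_ _ _. 0)(0 := (*), 1 := \<lambda>a b. c [a, b]))"
proof -
  let ?e = "(\<lambda>_ _ _. 0)(0 := (*)) :: nat \<Rightarrow> 'a \<Rightarrow> 'a \<Rightarrow> 'a"
  let ?m = "?e(1 := \<lambda>a b. c [a, b])"
  have zero: "associator ?m 0 a b d = 0" for a b d
  proof -
    have "{(p, q). p + q = (0::nat)} = {(0, 0)}" by auto
    then show ?thesis by (simp add: associator_def mult.assoc)
  qed
  have one: "associator ?m 1 a b d = 0" for a b d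
  proof -
    have "{(p, q). p + q = (1::nat)} = {(0, 1), (1, 0)}" by auto
    \<comment> \<open>Each summand of order 1 contains the coefficient of index 1, which is still 0
      in \<open>?e\<close>; inserting c then subtracts its coboundary, also 0.\<close>
    then have "associator ?e 1 a b d = 0" by (simp add: associator_def)
    then show ?thesis
      using associator_fun_upd[of 1 ?e "\<lambda>a b. c [a, b]" a b d] fun_cong[OF assms(2), of "[a, b, d]"]
      by (simp add: coboundary_2)
  qed
  have "bilinear_map (\<lambda>a b. c [a, b])" "equivariant_map (\<lambda>a b. c [a, b])"
    using c bilinear_map_cochain equivariant_map_cochain by (auto simp: equiv_cochains_def)
  then show ?thesis
    using zero one
    by (auto simp: truncated_deformation_def bilinear_map_mult bilinear_map_zero
        equivariant_map_mult equivariant_map_zero less_Suc_eq numeral_2_eq_2)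
qed

lemma equiv_formal_deformation_extending_cocycle:
  assumes triv: "carrier (equiv_cohomology 3) = {\<one>\<^bsub>equiv_cohomology 3\<^esub>}"
    and c: "c \<in> equiv_cochains 2" and "coboundary 2 c = (\<lambda>_. 0)"
  obtains m where "equiv_formal_deformation m" and "\<And>a b. m 1 a b = c [a, b]"
proof -
  let ?m = "(\<lambda>_ _ _. 0)(0 := (*), 1 := \<lambda>a b. c [a, b]) :: nat \<Rightarrow> 'a \<Rightarrow> 'a \<Rightarrow> 'a"
  \<comment> \<open>The extensions are not unique, so a whole sequence is obtained by dependent
    choice. The offset 2 reflects that c already settles orders 0 and 1; each step changes only the
    coefficient of index n + 2.\<close>
  have "\<exists>M. \<forall>n. (truncated_deformation (n + 2) (M n) \<and> M n 1 = (\<lambda>a b. c [a, b])) \<and>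
    (\<forall>i < n + 2. M (Suc n) i = M n i)"
  proof (rule dependent_nat_choice)
    show "\<exists>m. truncated_deformation (0 + 2) m \<and> m 1 = (\<lambda>a b. c [a, b])"
      by (rule exI[of _ ?m]) (use truncated_deformation_cocycle[OF c assms(3)] in \<open>simp add: numeral_2_eq_2\<close>)
  next
    fix m n assume m: "truncated_deformation (n + 2) m \<and> m 1 = (\<lambda>a b. c [a, b])"
    then obtain f where "truncated_deformation (Suc (n + 2)) (m(n + 2 := f))"
      using truncated_deformation_extend[OF triv, of "n + 2" m] by auto
    with m show "\<exists>m'. (truncated_deformation (Suc n + 2) m' \<and> m' 1 = (\<lambda>a b. c [a, b])) \<and>
        (\<forall>i < n + 2. m' i = m i)"
      by (intro exI[of _ "m(n + 2 := f)"]) auto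
  qed
  then obtain M where M: "truncated_deformation (n + 2) (M n)" "M n 1 = (\<lambda>a b. c [a, b])"
    and step: "i < n + 2 \<Longrightarrow> M (Suc n) i = M n i" for n i
    by blast
  \<comment> \<open>The diagonal is the limit: from stage n on, the coefficient of index n never
    changes again.\<close>
  define m where "m n = M n n" for n
  have agree: "M n i = m i" if "i \<le> n" for n i
    using that by (induction rule: dec_induct) (auto simp: m_def step)
  have bil: "bilinear_map (m i)" and eqv: "equivariant_map (m i)" and m0: "m 0 = (*)" for i
    using M(1)[of i] M(1)[of 0] by (auto simp: truncated_deformation_def m_def)
  \<comment> \<open>Order r sees only indices up to r, where m agrees with \<open>M r\<close>, and r
    < r + 2 lies below the truncation order of \<open>M r\<close>.\<close>
  have "associator m r a b d = 0" for r a b d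
    using M(1)[of r] associator_cong[of r m "M r"] agree by (simp add: truncated_deformation_def)
  then have "deformed_mult m (deformed_mult m u v) w = deformed_mult m u (deformed_mult m v w)" for u v w
    by (rule biadditive_family.deformed_mult_assoc[OF biadditive_family_bilinear[OF bil]])
  then have "equiv_formal_deformation m"
    using bil eqv m0
    by (auto simp: equiv_formal_deformation_def bilinear_map_def equivariant_map_def)
  moreover have "m 1 a b = c [a, b]" for a b
    using M(2)[of 1] by (simp add: m_def)
  ultimately show ?thesis by (rule that)
qed

end

theorem corollary4p9:
  fixes scale :: "'k::field_char_0 \<Rightarrow> 'a::ring \<Rightarrow> 'a"
    and G :: "('g, 'm) monoid_scheme"
    and \<phi> :: "'g \<Rightarrow> 'a \<Rightarrow> 'a"
  assumes "algebra_action scale G \<phi>"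
    and "finite (carrier G)"
    and "carrier (algebra_action.equiv_cohomology scale G \<phi> 3) =
           {\<one>\<^bsub>algebra_action.equiv_cohomology scale G \<phi> 3\<^esub>}"
  shows "\<forall>c \<in> algebra_action.equiv_cochains scale G \<phi> 2.
           assoc_algebra.coboundary scale 2 c = (\<lambda>_. 0) \<longrightarrow>
           (\<exists>m. algebra_action.equiv_formal_deformation scale G \<phi> m \<and>
                (\<forall>a b. m 1 a b = c [a, b]))"
proof -
  interpret algebra_action scale G \<phi> by fact
  show ?thesis
    using equiv_formal_deformation_extending_cocycle[OF assms(3)] by metis
qed

end
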